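(* Let $\Lambda=\mathbb{Z}[a_1,a_2,a_3]$ be the polynomial ring in three variables over $\mathbb{Z}$, let $c_i=a_i$ for $i=1,2,3$, and let $G=\{g\in \mathrm{GL}(3,\Lambda): g\bar c_3=\bar c_3\}$ be the stabilizer of the column $\bar c_3=(c_1,c_2,c_3)^{T}$ in $\mathrm{GL}(3,\Lambda)$. Let $G_t\le G$ be the tame stabilizer of $\bar c_3$. Then for every finite subset $L\subseteq G$, $$\mathrm{gp}(L,G_t)\ne G.$$
   Context: $\mathrm{gp}(L,G_t)$ denotes the subgroup generated by $L$ and $G_t$. $E$ is the identity $3\times3$ matrix and $E_{ij}$ the matrix unit with $1$ in position $(i,j)$ and $0$ elsewhere. The tame stabilizer $G_t$ is the subgroup of $G$ generated by all matrices (indices in $\{1,2,3\}$, $a\in\Lambda$) $$T_{i,j,k}(a)=E+ac_kE_{ij}-ac_jE_{ik}\quad (i\ne j,k;\ j<k),$$ $$S_{i,j}(a)=E+ac_ic_jE_{ii}-ac_i^2E_{ij}+ac_j^2E_{ji}-ac_ic_jE_{jj}\quad (i<j).$$ *)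

theory Defs
  imports
    "HOL-Analysis.Analysis"
    "HOL-Algebra.Generated_Groups"
    "HOL-Computational_Algebra.Polynomial"
begin

text \<open>
  \<open>\<int>[a\<^sub>1,a\<^sub>2,a\<^sub>3]\<close> is taken as the iterated polynomial ring \<open>\<int>[a\<^sub>1][a\<^sub>2][a\<^sub>3]\<close>:
  the innermost indeterminate is \<open>a\<^sub>1\<close>, the outermost one is \<open>a\<^sub>3\<close>.
\<close>

type_synonym int_poly3 = "int poly poly poly"

definition var1 :: int_poly3 where "var1 = [:[:[:0, 1:]:]:]"
definition var2 :: int_poly3 where "var2 = [:[:0, 1:]:]"
definition var3 :: int_poly3 where "var3 = [:0, 1:]"

definition GL3 :: "('a::comm_ring_1 ^ 3 ^ 3) monoid" where
  "GL3 = \<lparr>carrier = {g. invertible g}, mult = (**), one = mat 1\<rparr>"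

definition stabilizer :: "'a::comm_ring_1 ^ 3 \<Rightarrow> ('a ^ 3 ^ 3) monoid" where
  "stabilizer c = GL3\<lparr>carrier := {g \<in> carrier GL3. g *v c = c}\<rparr>"

text \<open>\<open>single_entry x i j\<close> is \<open>x E\<^sub>i\<^sub>j\<close>, with \<open>E\<^sub>i\<^sub>j\<close> the matrix unit.\<close>

definition single_entry :: "'a::comm_ring_1 \<Rightarrow> 3 \<Rightarrow> 3 \<Rightarrow> 'a ^ 3 ^ 3" where
  "single_entry x i j = (\<chi> k l. if k = i \<and> l = j then x else 0)"

definition tame_T :: "'a::comm_ring_1 ^ 3 \<Rightarrow> 3 \<Rightarrow> 3 \<Rightarrow> 3 \<Rightarrow> 'a \<Rightarrow> 'a ^ 3 ^ 3" where
  "tame_T c i j k a =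
     mat 1 + single_entry (a * c $ k) i j - single_entry (a * c $ j) i k"

definition tame_S :: "'a::comm_ring_1 ^ 3 \<Rightarrow> 3 \<Rightarrow> 3 \<Rightarrow> 'a \<Rightarrow> 'a ^ 3 ^ 3" where
  "tame_S c i j a =
     mat 1 + single_entry (a * c $ i * c $ j) i i - single_entry (a * (c $ i)\<^sup>2) i j
           + single_entry (a * (c $ j)\<^sup>2) j i - single_entry (a * c $ i * c $ j) j j"

text \<open>
  The indices are natural numbers in \<open>{1..3}\<close>, coerced to the index type \<open>3\<close> only afterwards:
  in that type \<open>3 = 0\<close>, hence \<open>3 < 1 < 2\<close>, which is not the intended order.
\<close>

definition tame_generators :: "'a::comm_ring_1 ^ 3 \<Rightarrow> ('a ^ 3 ^ 3) set" where
  "tame_generators c =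
     {tame_T c (of_nat i) (of_nat j) (of_nat k) a | (i::nat) (j::nat) (k::nat) a.
        {i, j, k} \<subseteq> {1..3} \<and> i \<noteq> j \<and> i \<noteq> k \<and> j < k} \<union>
     {tame_S c (of_nat i) (of_nat j) a | (i::nat) (j::nat) a. {i, j} \<subseteq> {1..3} \<and> i < j}"

definition tame_stabilizer :: "'a::comm_ring_1 ^ 3 \<Rightarrow> ('a ^ 3 ^ 3) set" where
  "tame_stabilizer c = generate (stabilizer c) (tame_generators c)"

lemma group_GL3: "group (GL3 :: ('a::comm_ring_1 ^ 3 ^ 3) monoid)"
proof (rule groupI)
  fix x :: "'a ^ 3 ^ 3" assume "x \<in> carrier GL3"
  then obtain y where y: "x ** y = mat 1" "y ** x = mat 1"
    by (auto simp: GL3_def invertible_def)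
  then show "\<exists>y\<in>carrier GL3. y \<otimes>\<^bsub>GL3\<^esub> x = \<one>\<^bsub>GL3\<^esub>"
    by (intro bexI[of _ y]) (auto simp: GL3_def invertible_def)
next
  fix x y :: "'a ^ 3 ^ 3" assume "x \<in> carrier GL3" "y \<in> carrier GL3"
  then obtain x' y' where h: "x ** x' = mat 1" "x' ** x = mat 1" "y ** y' = mat 1" "y' ** y = mat 1"
    by (auto simp: GL3_def invertible_def)
  have "(x ** y) ** (y' ** x') = mat 1" "(y' ** x') ** (x ** y) = mat 1"
    by (metis h matrix_mul_assoc matrix_mul_rid)+
  then show "x \<otimes>\<^bsub>GL3\<^esub> y \<in> carrier GL3"
    by (auto simp: GL3_def invertible_def)
next
  show "\<one>\<^bsub>GL3\<^esub> \<in> carrier (GL3 :: ('a ^ 3 ^ 3) monoid)"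
    by (auto simp: GL3_def invertible_def intro: exI[of _ "mat 1"])
qed (auto simp: GL3_def matrix_mul_assoc)

lemma subgroup_stabilizer:
  fixes c :: "'a::comm_ring_1 ^ 3"
  shows "subgroup (carrier (stabilizer c)) GL3"
proof -
  interpret group "GL3 :: ('a ^ 3 ^ 3) monoid" by (rule group_GL3)
  show ?thesis
  proof (rule subgroupI)
    show "carrier (stabilizer c) \<noteq> {}"
      using one_closed by (auto simp: stabilizer_def GL3_def intro!: exI[of _ "mat 1"])
  next
    fix a assume "a \<in> carrier (stabilizer c)"
    then have a: "a \<in> carrier GL3" "a *v c = c" by (auto simp: stabilizer_def)
    then have "inv\<^bsub>GL3\<^esub> a ** a = mat 1" using l_inv by (simp add: GL3_def)
    then have "inv\<^bsub>GL3\<^esub> a *v c = c"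
      by (metis a(2) matrix_vector_mul_assoc matrix_vector_mul_lid)
    with a inv_closed show "inv\<^bsub>GL3\<^esub> a \<in> carrier (stabilizer c)"
      by (auto simp: stabilizer_def)
  next
    fix a b assume "a \<in> carrier (stabilizer c)" "b \<in> carrier (stabilizer c)"
    then have ab: "a \<in> carrier GL3" "a *v c = c" "b \<in> carrier GL3" "b *v c = c"
      by (auto simp: stabilizer_def)
    have "(a \<otimes>\<^bsub>GL3\<^esub> b) *v c = c"
      using ab by (simp add: GL3_def flip: matrix_vector_mul_assoc)
    with ab m_closed show "a \<otimes>\<^bsub>GL3\<^esub> b \<in> carrier (stabilizer c)"
      by (auto simp: stabilizer_def)
  qed (auto simp: stabilizer_def)
qed

lemma group_stabilizer: "group (stabilizer c)"
  using group.subgroup_imp_group[OF group_GL3 subgroup_stabilizer[of c]]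
  by (simp add: stabilizer_def)

lemma in_stabilizerI:
  assumes "g ** h = mat 1" "h ** g = mat 1" "g *v c = c"
  shows "g \<in> carrier (stabilizer c)"
  using assms by (auto simp: stabilizer_def GL3_def invertible_def)

lemma tame_T_mult_vec:
  assumes "i \<noteq> j" "i \<noteq> k"
  shows "tame_T c i j k a *v c = c"
  using assms exhaust_3[of i] exhaust_3[of j] exhaust_3[of k]
  by (elim disjE; simp add: vec_eq_iff forall_3 sum_3 matrix_vector_mult_def tame_T_def
        single_entry_def mat_def algebra_simps)

lemma tame_T_mult:
  assumes "i \<noteq> j" "i \<noteq> k"
  shows "tame_T c i j k a ** tame_T c i j k b = tame_T c i j k (a + b)"
  using assms exhaust_3[of i] exhaust_3[of j] exhaust_3[of k]
  by (elim disjE; simp add: vec_eq_iff forall_3 sum_3 matrix_matrix_mult_def tame_T_def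
        single_entry_def mat_def algebra_simps)

lemma tame_T_0: "tame_T c i j k 0 = mat 1"
  by (simp add: tame_T_def single_entry_def vec_eq_iff)

lemma tame_S_mult_vec:
  assumes "i \<noteq> j"
  shows "tame_S c i j a *v c = c"
  using assms exhaust_3[of i] exhaust_3[of j]
  by (elim disjE; simp add: vec_eq_iff forall_3 sum_3 matrix_vector_mult_def tame_S_def
        single_entry_def mat_def algebra_simps power2_eq_square)

lemma tame_S_mult:
  assumes "i \<noteq> j"
  shows "tame_S c i j a ** tame_S c i j b = tame_S c i j (a + b)"
  using assms exhaust_3[of i] exhaust_3[of j]
  by (elim disjE; simp add: vec_eq_iff forall_3 sum_3 matrix_matrix_mult_def tame_S_def
        single_entry_def mat_def algebra_simps power2_eq_square)

lemma tame_S_0: "tame_S c i j 0 = mat 1"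
  by (simp add: tame_S_def single_entry_def vec_eq_iff)

lemma of_nat_index_3:
  assumes "i \<in> {1..3::nat}" "j \<in> {1..3}"
  shows "(of_nat i :: 3) = of_nat j \<longleftrightarrow> i = j"
proof -
  have "i = 1 \<or> i = 2 \<or> i = 3" "j = 1 \<or> j = 2 \<or> j = 3" using assms by auto
  then show ?thesis by auto
qed

lemma tame_generators_subset: "tame_generators c \<subseteq> carrier (stabilizer c)"
proof -
  have "tame_T c i j k a \<in> carrier (stabilizer c)" if "i \<noteq> j" "i \<noteq> k" for i j k a
    using that
    by (intro in_stabilizerI[of _ "tame_T c i j k (- a)"])
       (simp_all add: tame_T_mult tame_T_0 tame_T_mult_vec)
  moreover have "tame_S c i j a \<in> carrier (stabilizer c)" if "i \<noteq> j" for i j a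
    using that
    by (intro in_stabilizerI[of _ "tame_S c i j (- a)"])
       (simp_all add: tame_S_mult tame_S_0 tame_S_mult_vec)
  ultimately show ?thesis
    unfolding tame_generators_def by (auto simp: of_nat_index_3)
qed

lemma subgroup_tame_stabilizer: "subgroup (tame_stabilizer c) (stabilizer c)"
  unfolding tame_stabilizer_def
  by (rule group.generate_is_subgroup[OF group_stabilizer tame_generators_subset])

end

theory Submission
  imports Defs "HOL-Computational_Algebra.Primes"
begin

text \<open>
  The idea is to map the stabilizer \<open>G\<close> of \<open>c\<close> to \<open>2 \<times> 2\<close> matrices over \<open>\<int>[t]\<close> in such a way that
  the tame part becomes elementary, and then to use that \<open>\<int>[t]\<close>, unlike \<open>\<rat>[t]\<close>, admits unimodular
  columns to which division with remainder cannot even be applied once.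

  \<^item> Specializing \<open>a\<^sub>1 \<mapsto> t\<close>, \<open>a\<^sub>2 \<mapsto> 0\<close>, \<open>a\<^sub>3 \<mapsto> 1\<close> turns \<open>c\<close> into \<open>(t, 0, 1)\<close>. The quotient of the free module
    of rank 3 by this column is free of rank 2, and \<open>G\<close> acts on it (\<open>quotient_action_mult\<close>). Because \<open>c\<^sub>2\<close>
    becomes 0 and \<open>c\<^sub>3\<close> becomes a unit, every tame generator acts as an upper or lower unitriangular
    matrix over \<open>\<int>[t]\<close> (\<open>quotient_action_tame\<close>).

  \<^item> A matrix in \<open>GL(2, \<rat>[t])\<close> is a product of unitriangular and of constant matrices, by the Euclidean
    algorithm. This factorization involves only finitely many rational numbers. So for a finite set
    \<open>L\<close> there is a prime \<open>p\<close> such that all elements of \<open>L\<close>, and their inverses, factorize over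
    \<open>R = \<int>\<^sub>(\<^sub>p\<^sub>)\<close>, the rationals with denominator prime to \<open>p\<close>. Consequently \<open>L\<close> and the tame stabilizer
    preserve the set \<open>W\<close> of all columns that are obtained from \<open>(1, 0)\<close> by unitriangular matrices over
    \<open>R[t]\<close> and matrices in \<open>GL(2, R)\<close> (\<open>invertible_preserves_orbit\<close>).

  \<^item> Up to a matrix in \<open>GL(2, R)\<close>, a column of \<open>W\<close> is \<open>(1, 0)\<close> or has entries of different degrees such
    that the leading coefficient of the entry of smaller degree divides the other one in \<open>R\<close>
    (\<open>reduced_lead_coeff\<close>). This is an argument of P. M. Cohn. It excludes \<open>(1 + p t, p\<^sup>2)\<close>, because \<open>p\<^sup>2\<close>
    does not divide \<open>p\<close> in \<open>R\<close>.

  \<^item> On the other hand \<open>(1 + p t, p\<^sup>2)\<close> is the image of \<open>(1, 0)\<close> under an element of \<open>G\<close>, namely under the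
    transvection along \<open>(a\<^sub>1, p, 0)\<close> modulo \<open>c\<close> (\<open>quotient_action_transvection\<close>). This element does not
    belong to the subgroup generated by \<open>L\<close> and the tame stabilizer.
\<close>

section \<open>Vectors reachable from the first unit vector over a subring of a field\<close>

definition shear :: "'a::comm_ring_1 \<Rightarrow> 'a ^ 2 ^ 2" where
  "shear f = vector [vector [1, f], vector [0, 1]]"

definition const_mat :: "'a::comm_ring_1 ^ 2 ^ 2 \<Rightarrow> 'a poly ^ 2 ^ 2" where
  "const_mat M = (\<chi> i j. [:M $ i $ j:])"

definition swap :: "'a::comm_ring_1 ^ 2 ^ 2" where
  "swap = vector [vector [0, 1], vector [1, 0]]"

lemmas mat2_simps = vec_eq_iff forall_2 sum_2 matrix_matrix_mult_def matrix_vector_mult_def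
  shear_def const_mat_def swap_def mat_def

lemma const_mat_mult: "const_mat (M ** N) = const_mat M ** const_mat N"
  by (simp add: mat2_simps mult.commute)

lemma const_mat_one: "const_mat (mat 1) = mat 1"
  by (simp add: mat2_simps one_pCons)

lemma shear_add: "shear (f + g) = shear f ** shear g"
  by (simp add: mat2_simps)

lemma shear_const: "shear [:c:] = const_mat (shear c)"
  by (simp add: mat2_simps one_pCons)

lemma degree_smult_add:
  fixes p q :: "'a::idom poly"
  assumes "a \<noteq> 0" "p \<noteq> 0" "q = 0 \<or> degree q < degree p"
  shows "degree (smult a p + smult b q) = degree p"
    and "lead_coeff (smult a p + smult b q) = a * lead_coeff p"
proof -
  have "smult b q = 0 \<or> degree (smult b q) < degree (smult a p)"
    using assms by auto
  then show "degree (smult a p + smult b q) = degree p"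
    using assms(1) by (auto simp: degree_add_eq_left)
  then show "lead_coeff (smult a p + smult b q) = a * lead_coeff p"
    using assms by (auto simp: coeff_eq_0)
qed

locale field_subring =
  fixes S :: "'a::field set"
  assumes zero_mem: "0 \<in> S"
    and one_mem: "1 \<in> S"
    and add_mem: "x \<in> S \<Longrightarrow> y \<in> S \<Longrightarrow> x + y \<in> S"
    and minus_mem: "x \<in> S \<Longrightarrow> - x \<in> S"
    and mult_mem: "x \<in> S \<Longrightarrow> y \<in> S \<Longrightarrow> x * y \<in> S"
begin

definition polys :: "'a poly set" where
  "polys = {f. \<forall>n. coeff f n \<in> S}"

definition GL2 :: "('a ^ 2 ^ 2) set" where
  "GL2 = {M. (\<forall>i j. M $ i $ j \<in> S) \<and> det M \<noteq> 0 \<and> inverse (det M) \<in> S}"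

text \<open>
  Images of \<open>(1, 0)\<close> under words in shears and constant matrices that are empty or start with a
  shear, and in which no two neighbouring factors can be merged:
  a constant matrix with lower left entry 0 could be moved past a shear, and a shear by a constant
  is itself a constant matrix. Without cancellation between the factors, degrees grow strictly
  along the word.
\<close>

inductive_set reduced :: "('a poly ^ 2) set" where
  start: "vector [1, 0] \<in> reduced"
| step: "\<lbrakk>v \<in> reduced; M \<in> GL2; M $ 2 $ 1 \<noteq> 0; f \<in> polys; degree f > 0\<rbrakk>
    \<Longrightarrow> shear f *v (const_mat M *v v) \<in> reduced"

text \<open>
  As \<open>orbit_const_mat\<close> and \<open>orbit_shear\<close> show, this is the orbit of \<open>(1, 0)\<close> under the group generated by
  the constant invertible matrices and the shears over \<open>S\<close>; the definition describes it by normal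
  forms.
\<close>

definition orbit :: "('a poly ^ 2) set" where
  "orbit = {const_mat M *v v | M v. M \<in> GL2 \<and> v \<in> reduced}"

lemma GL2_one: "mat 1 \<in> GL2"
  by (auto simp: GL2_def mat_def zero_mem one_mem det_2)

lemma GL2_mult: "M \<in> GL2 \<Longrightarrow> N \<in> GL2 \<Longrightarrow> M ** N \<in> GL2"
  by (auto simp: GL2_def det_mul mult_mem)
    (simp add: matrix_matrix_mult_def sum_2 add_mem mult_mem)

lemma GL2_shear: "c \<in> S \<Longrightarrow> shear c \<in> GL2"
  by (auto simp: GL2_def shear_def det_2 forall_2 zero_mem one_mem)

lemma GL2_swap: "swap \<in> GL2"
  by (auto simp: GL2_def swap_def det_2 forall_2 zero_mem one_mem minus_mem)

lemma reduced_subset_orbit: "reduced \<subseteq> orbit"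
proof
  fix v assume "v \<in> reduced"
  moreover have "const_mat (mat 1) *v v = v"
    by (simp add: const_mat_one)
  ultimately show "v \<in> orbit"
    unfolding orbit_def using GL2_one by (metis (mono_tags, lifting) mem_Collect_eq)
qed

lemma orbit_const_mat:
  assumes "M \<in> GL2" "w \<in> orbit"
  shows "const_mat M *v w \<in> orbit"
proof -
  obtain N v where "N \<in> GL2" "v \<in> reduced" "w = const_mat N *v v"
    using assms(2) by (auto simp: orbit_def)
  then show ?thesis
    using GL2_mult[OF assms(1)] unfolding orbit_def
    by (auto simp: matrix_vector_mul_assoc simp flip: const_mat_mult)
qed

text \<open>A shear of positive degree extends a reduced word; one of degree 0 is absorbed by a constant matrix.\<close>

lemma orbit_shear_GL2:
  assumes "v \<in> reduced" "M \<in> GL2" "M $ 2 $ 1 \<noteq> 0" "f \<in> polys"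
  shows "shear f *v (const_mat M *v v) \<in> orbit"
proof (cases "degree f = 0")
  case True
  then obtain c where c: "f = [:c:]"
    by (rule degree_eq_zeroE)
  have "coeff f 0 \<in> S"
    using assms(4) by (simp add: polys_def)
  then have "c \<in> S"
    by (simp add: c)
  then show ?thesis
    unfolding c shear_const
    using assms(1,2) reduced_subset_orbit by (intro orbit_const_mat GL2_shear) auto
next
  case False
  then show ?thesis
    using reduced.step[OF assms(1-4)] reduced_subset_orbit by auto
qed

text \<open>
  Rewriting a word into normal form: if the leading constant matrix is upper triangular, then it
  commutes with the shear up to rescaling the latter, which then either merges with the preceding
  shear of the word or fixes \<open>(1, 0)\<close>.
\<close>

lemma orbit_shear:
  assumes f: "f \<in> polys" and w: "w \<in> orbit"
  shows "shear f *v w \<in> orbit"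
proof -
  obtain M v where M: "M \<in> GL2" and v: "v \<in> reduced" and w: "w = const_mat M *v v"
    using w by (auto simp: orbit_def)
  show ?thesis
  proof (cases "M $ 2 $ 1 = 0")
    case False
    then show ?thesis
      unfolding w using orbit_shear_GL2[OF v M _ f] by simp
  next
    case True
    define \<alpha> \<delta> where "\<alpha> = M $ 1 $ 1" and "\<delta> = M $ 2 $ 2"
    have unit: "\<alpha> * \<delta> \<noteq> 0" "inverse (\<alpha> * \<delta>) \<in> S" and "\<delta> \<in> S"
      using M True by (auto simp: GL2_def det_2 \<alpha>_def \<delta>_def)
    \<comment> \<open>The scaling factor lies in \<open>S\<close> since its denominator divides the unit \<open>det M\<close>.\<close>
    then have "\<delta> * \<delta> * inverse (\<alpha> * \<delta>) \<in> S"
      by (intro mult_mem)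
    then have ratio: "\<delta> / \<alpha> \<in> S"
      using unit by (simp add: field_simps)
    define f' where "f' = smult (\<delta> / \<alpha>) f"
    have f': "f' \<in> polys"
      using f ratio by (auto simp: polys_def f'_def intro: mult_mem[of "\<delta> / \<alpha>", simplified])
    have "shear f ** const_mat M = const_mat M ** shear f'"
      using True unit by (simp add: mat2_simps f'_def flip: \<alpha>_def \<delta>_def)
    then have "shear f *v w = const_mat M *v (shear f' *v v)"
      unfolding w by (simp add: matrix_vector_mul_assoc)
    moreover have "shear f' *v v \<in> orbit"
      using v
    proof cases
      case start
      then have "shear f' *v v = v"
        by (simp add: mat2_simps)
      then show ?thesis
        using v reduced_subset_orbit by auto
    next
      case (step v0 N g)
      have "shear f' *v v = shear (f' + g) *v (const_mat N *v v0)"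
        by (simp add: step(1) shear_add matrix_vector_mul_assoc matrix_mul_assoc)
      moreover have "f' + g \<in> polys"
        using f' step(5) by (auto simp: polys_def add_mem)
      ultimately show ?thesis
        using orbit_shear_GL2[OF step(2,3,4)] by simp
    qed
    ultimately show ?thesis
      using orbit_const_mat[OF M] by simp
  qed
qed

lemma orbit_shear_transpose:
  assumes "f \<in> polys" "w \<in> orbit"
  shows "transpose (shear f) *v w \<in> orbit"
proof -
  have "transpose (shear f) = const_mat swap ** shear f ** const_mat swap"
    by (simp add: mat2_simps transpose_def one_pCons)
  then show ?thesis
    using assms by (simp add: orbit_const_mat orbit_shear GL2_swap flip: matrix_vector_mul_assoc)
qed

text \<open>
  A constant matrix with nonzero lower left entry \<open>m\<close> multiplies the dominating leading coefficient
  by \<open>m\<close> and puts it into the second row as that of some \<open>y\<close>. A subsequent shear by \<open>f\<close> makes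
  \<open>f * y\<close> the dominating term of the first row. Thus the quotient of the two leading coefficients is
  that of \<open>f\<close>.
\<close>

lemma reduced_lead_coeff:
  assumes "v \<in> reduced"
  shows "v = vector [1, 0] \<or>
    v $ 2 \<noteq> 0 \<and> degree (v $ 2) < degree (v $ 1) \<and>
    (\<exists>s\<in>S. lead_coeff (v $ 1) = s * lead_coeff (v $ 2))"
  using assms
proof induction
  case start
  then show ?case by simp
next
  case (step v M f)
  define x y where "x = smult (M $ 1 $ 1) (v $ 1) + smult (M $ 1 $ 2) (v $ 2)"
    and "y = smult (M $ 2 $ 1) (v $ 1) + smult (M $ 2 $ 2) (v $ 2)"
  have v: "v $ 1 \<noteq> 0" "v $ 2 = 0 \<or> degree (v $ 2) < degree (v $ 1)"
    using step.IH by auto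
  have deg_y: "degree y = degree (v $ 1)" and lc_y: "lead_coeff y = M $ 2 $ 1 * lead_coeff (v $ 1)"
    using degree_smult_add[OF step.hyps(3) v] by (simp_all add: y_def)
  then have "y \<noteq> 0"
    using step.hyps(3) v(1) by (metis leading_coeff_0_iff mult_eq_0_iff)
  have "degree x \<le> degree y"
    unfolding x_def deg_y using v(2)
    by (intro degree_add_le) (auto intro: order.trans[OF degree_smult_le])
  have "f \<noteq> 0"
    using step.hyps(5) by auto
  then have deg_fy: "degree (f * y) = degree f + degree y"
    using \<open>y \<noteq> 0\<close> by (simp add: degree_mult_eq)
  then have less: "degree x < degree (f * y)"
    using \<open>degree x \<le> degree y\<close> step.hyps(5) by simp
  have "degree (x + f * y) = degree f + degree y"
    using degree_add_eq_right[OF less] deg_fy by simp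
  moreover have "lead_coeff (x + f * y) = lead_coeff f * lead_coeff y"
    using lead_coeff_add_le[OF less] by (simp add: lead_coeff_mult)
  moreover have "lead_coeff f \<in> S"
    using step.hyps(4) by (simp add: polys_def)
  moreover have "(shear f *v (const_mat M *v v)) $ 1 = x + f * y"
    and "(shear f *v (const_mat M *v v)) $ 2 = y"
    by (simp_all add: mat2_simps x_def y_def)
  ultimately show ?case
    using \<open>y \<noteq> 0\<close> step.hyps(5) by auto
qed

text \<open>
  The second entry is constant and the first is not, so the constant matrix of a normal form would
  have to be upper triangular. Its diagonal entries are units, so \<open>p\<^sup>2\<close> would divide \<open>p\<close> in \<open>S\<close>.
\<close>

lemma Cohn_column_not_in_orbit:
  assumes "p \<noteq> 0" "inverse p \<notin> S"
  shows "vector [[:1, p:], [:p\<^sup>2:]] \<notin> orbit"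
proof
  assume "vector [[:1, p:], [:p\<^sup>2:]] \<in> orbit"
  then obtain M v where M: "M \<in> GL2" and v: "v \<in> reduced"
    and eq: "vector [[:1, p:], [:p\<^sup>2:]] = const_mat M *v v"
    by (auto simp: orbit_def)
  define x y where "x = v $ 1" and "y = v $ 2"
  have row1: "[:1, p:] = smult (M $ 1 $ 1) x + smult (M $ 1 $ 2) y"
    and row2: "[:p\<^sup>2:] = smult (M $ 2 $ 1) x + smult (M $ 2 $ 2) y"
    using eq by (simp_all add: mat2_simps x_def y_def)
  have "v \<noteq> vector [1, 0]"
  proof
    assume "v = vector [1, 0]"
    then have "[:1, p:] = [:M $ 1 $ 1:]"
      using row1 by (simp add: x_def y_def one_pCons)
    then show False
      using assms(1) by simp
  qed
  then obtain s where y: "y \<noteq> 0" "degree y < degree x" and s: "s \<in> S" "lead_coeff x = s * lead_coeff y"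
    using reduced_lead_coeff[OF v] by (auto simp: x_def y_def)
  have "x \<noteq> 0"
    using y(2) by auto
  have M21: "M $ 2 $ 1 = 0"
  proof (rule ccontr)
    assume "M $ 2 $ 1 \<noteq> 0"
    then have "degree [:p\<^sup>2:] = degree x"
      unfolding row2 using \<open>x \<noteq> 0\<close> y(2) by (intro degree_smult_add) auto
    then show False
      using y(2) by simp
  qed
  then have unit: "M $ 1 $ 1 * M $ 2 $ 2 \<noteq> 0" "inverse (M $ 1 $ 1 * M $ 2 $ 2) \<in> S"
    and mem: "M $ 1 $ 1 \<in> S"
    using M by (auto simp: GL2_def det_2)
  have "lead_coeff [:1, p:] = M $ 1 $ 1 * lead_coeff x"
    unfolding row1 using \<open>x \<noteq> 0\<close> y(2) unit by (intro degree_smult_add) auto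
  then have "p = M $ 1 $ 1 * lead_coeff x"
    using assms(1) by simp
  moreover have "p\<^sup>2 = M $ 2 $ 2 * lead_coeff y"
    using arg_cong[OF row2, of lead_coeff] M21 by simp
  ultimately have "inverse p = M $ 1 $ 1 * M $ 1 $ 1 * inverse (M $ 1 $ 1 * M $ 2 $ 2) * s"
    using s(2) unit assms(1) by (simp add: field_simps power2_eq_square)
  also have "\<dots> \<in> S"
    by (intro mult_mem mem unit s)
  finally show False
    using assms(2) by simp
qed

end

section \<open>Matrices over a polynomial ring over a field\<close>

lemma finite_range_coeff: "finite (range (coeff (f :: 'a::zero poly)))"
proof (rule finite_subset)
  show "range (coeff f) \<subseteq> insert 0 (coeff f ` {..degree f})"
    by (auto simp: image_iff) (metis atMost_iff coeff_eq_0 not_le)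
qed simp

text \<open>
  By the Euclidean algorithm on the first column, \<open>A\<close> is a product of shears and constant matrices;
  \<open>F\<close> collects the coefficients of these factors and the inverses of the determinants. The size that
  decreases is that of the lower left entry, with 0 below the nonzero constants.
\<close>

lemma invertible_preserves_orbit:
  fixes A :: "'a::field poly ^ 2 ^ 2"
  assumes "det A dvd 1"
  shows "\<exists>F. finite F \<and> (\<forall>S. field_subring S \<longrightarrow> F \<subseteq> S \<longrightarrow>
    (\<forall>w\<in>field_subring.orbit S. A *v w \<in> field_subring.orbit S))"
  using assms
proof (induction "if A $ 2 $ 1 = 0 then 0 else Suc (degree (A $ 2 $ 1))" arbitrary: A rule: less_induct)
  case less
  define a b c d where "a = A $ 1 $ 1" and "b = A $ 1 $ 2" and "c = A $ 2 $ 1" and "d = A $ 2 $ 2"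
  note entries = a_def[symmetric] b_def[symmetric] c_def[symmetric] d_def[symmetric]
  have det_A: "det A = a * d - b * c"
    by (simp add: det_2 entries)
  show ?case
  proof (cases "c = 0")
    case True
    then have "a * d dvd 1"
      using less.prems det_A by simp
    then have "is_unit a" "is_unit d"
      using dvd_mult_left dvd_mult_right by blast+
    then obtain \<alpha> \<delta> where ad: "a = [:\<alpha>:]" "d = [:\<delta>:]" "\<alpha> \<noteq> 0" "\<delta> \<noteq> 0"
      by (elim is_unit_polyE) (auto simp: dvd_field_iff)
    define D :: "'a ^ 2 ^ 2" where "D = vector [vector [\<alpha>, 0], vector [0, \<delta>]]"
    define f where "f = smult (inverse \<alpha>) b"
    have A: "A = const_mat D ** shear f"
      using True ad by (simp add: mat2_simps entries D_def f_def)
    show ?thesis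
    proof (intro exI conjI allI impI ballI)
      show "finite (insert \<alpha> (insert \<delta> (insert (inverse (\<alpha> * \<delta>)) (range (coeff f)))))"
        by (simp only: finite_insert finite_range_coeff)
      fix S w
      assume S: "field_subring S" and "w \<in> field_subring.orbit S"
        and F: "insert \<alpha> (insert \<delta> (insert (inverse (\<alpha> * \<delta>)) (range (coeff f)))) \<subseteq> S"
      interpret field_subring S by (rule S)
      have "D \<in> GL2"
        using F ad by (auto simp: GL2_def D_def forall_2 det_2 zero_mem)
      moreover have "f \<in> polys"
        using F by (auto simp: polys_def)
      ultimately show "A *v w \<in> orbit"
        unfolding A using \<open>w \<in> orbit\<close>
        by (simp add: orbit_const_mat orbit_shear flip: matrix_vector_mul_assoc)
    qed
  next
    case False
    define q where "q = a div c"
    define B :: "'a poly ^ 2 ^ 2" where "B = vector [vector [c, d], vector [a - q * c, b - q * d]]"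
    have r: "a - q * c = a mod c"
      by (simp add: q_def minus_div_mult_eq_mod)
    have A: "A = shear q ** const_mat swap ** B"
      by (simp add: mat2_simps entries B_def one_pCons)
    have "det B = - det A"
      unfolding det_A by (simp add: det_2 B_def algebra_simps)
    then have "det B dvd 1"
      using less.prems by simp
    moreover have "(if B $ 2 $ 1 = 0 then 0 else Suc (degree (B $ 2 $ 1)))
        < (if A $ 2 $ 1 = 0 then 0 else Suc (degree (A $ 2 $ 1)))"
      using False degree_mod_less[OF False, of a] by (auto simp: B_def entries r)
    ultimately obtain F where F: "finite F" "\<And>S w. field_subring S \<Longrightarrow> F \<subseteq> S \<Longrightarrow>
        w \<in> field_subring.orbit S \<Longrightarrow> B *v w \<in> field_subring.orbit S"
      using less.hyps[of B] by blast
    show ?thesis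
    proof (intro exI conjI allI impI ballI)
      show "finite (F \<union> range (coeff q))"
        by (simp only: finite_Un F finite_range_coeff)
      fix S w
      assume S: "field_subring S" and w: "w \<in> field_subring.orbit S" and sub: "F \<union> range (coeff q) \<subseteq> S"
      interpret field_subring S by (rule S)
      have "q \<in> polys"
        using sub by (auto simp: polys_def)
      moreover have "B *v w \<in> orbit"
        using F(2)[OF S _ w] sub by auto
      ultimately show "A *v w \<in> orbit"
        unfolding A
        by (simp add: orbit_const_mat orbit_shear GL2_swap flip: matrix_vector_mul_assoc)
    qed
  qed
qed

section \<open>Localizations of the integers\<close>

definition localization :: "int \<Rightarrow> rat set" where
  "localization p = {of_int a / of_int b | a b. \<not> p dvd b}"

lemma of_int_in_localization:
  assumes "prime p"
  shows "of_int a \<in> localization p"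
proof -
  have "\<not> p dvd 1"
    using assms not_prime_unit by blast
  moreover have "(of_int a :: rat) = of_int a / of_int 1"
    by simp
  ultimately show ?thesis
    unfolding localization_def by blast
qed

lemma field_subring_localization:
  assumes "prime p"
  shows "field_subring (localization p)"
proof
  show "0 \<in> localization p" "1 \<in> localization p"
    using of_int_in_localization[OF assms, of 0] of_int_in_localization[OF assms, of 1] by simp_all
next
  fix x y assume "x \<in> localization p" "y \<in> localization p"
  then obtain a b a' b' where x: "x = of_int a / of_int b" "\<not> p dvd b"
    and y: "y = of_int a' / of_int b'" "\<not> p dvd b'"
    by (auto simp: localization_def)
  have nz: "b \<noteq> 0" "b' \<noteq> 0" and "\<not> p dvd b * b'"
    using x y assms by (auto simp: prime_dvd_mult_iff)
  moreover have "x + y = of_int (a * b' + a' * b) / of_int (b * b')"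
    and "x * y = of_int (a * a') / of_int (b * b')"
    using nz by (auto simp: x y field_simps)
  ultimately show "x + y \<in> localization p" "x * y \<in> localization p"
    unfolding localization_def by blast+
next
  fix x assume "x \<in> localization p"
  then obtain a b where "x = of_int a / of_int b" "\<not> p dvd b"
    by (auto simp: localization_def)
  moreover from this have "- x = of_int (- a) / of_int b"
    by simp
  ultimately show "- x \<in> localization p"
    unfolding localization_def by blast
qed

lemma inverse_prime_not_in_localization:
  assumes "prime p"
  shows "inverse (of_int p) \<notin> localization p"
proof
  assume "inverse (of_int p) \<in> localization p"
  then obtain a b where ab: "inverse (of_int p) = (of_int a / of_int b :: rat)" "\<not> p dvd b"
    by (auto simp: localization_def)
  have "b \<noteq> 0" "p \<noteq> 0"
    using ab(2) assms by auto
  then have "(of_int b :: rat) = of_int (p * a)"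
    using ab(1) by (simp add: field_simps)
  then have "b = p * a"
    by (simp only: of_int_eq_iff)
  then show False
    using ab(2) by simp
qed

text \<open>Any prime greater than the product of all denominators will do.\<close>

lemma finite_subset_localization:
  assumes "finite F"
  shows "\<exists>p. prime p \<and> F \<subseteq> localization p"
proof -
  define N where "N = (\<Prod>x\<in>F. snd (quotient_of x))"
  have "N > 0"
    unfolding N_def by (intro prod_pos) (simp add: quotient_of_denom_pos')
  obtain n :: nat where n: "prime n" "n > nat N"
    using bigger_prime by blast
  have "F \<subseteq> localization (int n)"
  proof
    fix x assume "x \<in> F"
    then have "snd (quotient_of x) dvd N"
      unfolding N_def by (rule dvd_prodI[OF assms])
    moreover have "\<not> int n dvd N"
      using n(2) \<open>N > 0\<close> zdvd_not_zless[of N "int n"] by auto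
    ultimately have "\<not> int n dvd snd (quotient_of x)"
      using dvd_trans by blast
    moreover have "x = of_int (fst (quotient_of x)) / of_int (snd (quotient_of x))"
      by (rule quotient_of_div) simp
    ultimately show "x \<in> localization (int n)"
      unfolding localization_def by blast
  qed
  then show ?thesis
    using n(1) by (metis prime_nat_int_transfer)
qed

section \<open>The stabilizer acting on a specialized quotient\<close>

definition specialize :: "int_poly3 \<Rightarrow> rat poly" where
  "specialize f = map_poly of_int (poly (poly f 1) 0)"

lemma specialize_0 [simp]: "specialize 0 = 0"
  and specialize_1 [simp]: "specialize 1 = 1"
  and specialize_add [simp]: "specialize (f + g) = specialize f + specialize g"
  and specialize_minus [simp]: "specialize (- f) = - specialize f"
  and specialize_diff [simp]: "specialize (f - g) = specialize f - specialize g"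
  and specialize_mult [simp]: "specialize (f * g) = specialize f * specialize g"
  by (auto simp: specialize_def poly_eq_iff coeff_map_poly coeff_mult)

lemma specialize_vars [simp]:
  "specialize var1 = [:0, 1:]" "specialize var2 = 0" "specialize var3 = 1"
  by (simp_all add: specialize_def var1_def var2_def var3_def map_poly_pCons)

lemma specialize_of_int [simp]: "specialize (of_int n) = [:of_int n:]"
  by (simp add: specialize_def of_int_poly map_poly_pCons)

lemma coeff_specialize: "coeff (specialize f) n \<in> \<int>"
  by (simp add: specialize_def coeff_map_poly)

text \<open>
  The column \<open>c\<close> specializes to \<open>(t, 0, 1)\<close>. Modulo this column the first two unit vectors \<open>e\<^sub>1, e\<^sub>2\<close> form
  a basis, and \<open>e\<^sub>3\<close> is \<open>- t e\<^sub>1\<close>. The following is the matrix in this basis of the action that \<open>g\<close>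
  induces on the quotient.
\<close>

definition quotient_action :: "int_poly3 ^ 3 ^ 3 \<Rightarrow> rat poly ^ 2 ^ 2" where
  "quotient_action g = vector
    [vector [specialize (g $ 1 $ 1 - var1 * g $ 3 $ 1), specialize (g $ 1 $ 2 - var1 * g $ 3 $ 2)],
     vector [specialize (g $ 2 $ 1), specialize (g $ 2 $ 2)]]"

abbreviation vars :: "int_poly3 ^ 3" where
  "vars \<equiv> vector [var1, var2, var3]"

text \<open>
  That \<open>g\<close> fixes \<open>c\<close> expresses its third column by the first two; this makes the induced action
  on the quotient well defined, hence multiplicative.
\<close>

lemma quotient_action_mult:
  assumes "g *v vars = vars"
  shows "quotient_action (g ** h) = quotient_action g ** quotient_action h"
proof -
  define t where "t = specialize var1"
  have "specialize ((g *v vars) $ i) = specialize (vars $ i)" for i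
    by (simp add: assms)
  from this[of 1] this[of 2] this[of 3]
  have "specialize (g $ 1 $ 1) * t + specialize (g $ 1 $ 3) = t"
    "specialize (g $ 2 $ 1) * t + specialize (g $ 2 $ 3) = 0"
    "specialize (g $ 3 $ 1) * t + specialize (g $ 3 $ 3) = 1"
    by (simp_all add: matrix_vector_mult_def sum_3 t_def del: specialize_vars(1))
  then have col: "specialize (g $ 1 $ 3) = t - t * specialize (g $ 1 $ 1)"
    "specialize (g $ 2 $ 3) = - t * specialize (g $ 2 $ 1)"
    "specialize (g $ 3 $ 3) = 1 - t * specialize (g $ 3 $ 1)"
    by (simp_all add: eq_diff_eq eq_neg_iff_add_eq_0 add.commute mult.commute)
  show ?thesis
    by (simp add: quotient_action_def vec_eq_iff forall_2 matrix_matrix_mult_def sum_2 sum_3 col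
        algebra_simps flip: t_def del: specialize_vars(1))
qed

lemma quotient_action_one: "quotient_action (mat 1) = mat 1"
  by (simp add: quotient_action_def vec_eq_iff forall_2 mat_def)

lemma det_quotient_action:
  assumes "g \<in> carrier (stabilizer vars)"
  shows "det (quotient_action g) dvd 1"
proof -
  obtain h where "g ** h = mat 1" "g *v vars = vars"
    using assms by (auto simp: stabilizer_def GL3_def invertible_def)
  then have "quotient_action g ** quotient_action h = mat 1"
    by (simp add: quotient_action_one flip: quotient_action_mult)
  then have "det (quotient_action g) * det (quotient_action h) = 1"
    by (metis det_mul det_I)
  then show ?thesis
    by (metis dvd_triv_left)
qed

text \<open>
  A tame generator adds to each vector a multiple of one of the unit vectors, up to a multiple of
  \<open>c\<close>; the multiple is a linear form that vanishes on this unit vector. In the quotient, all three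
  unit vectors are multiples of \<open>e\<^sub>1\<close> or \<open>e\<^sub>2\<close>.
\<close>

lemma quotient_action_tame:
  assumes "g \<in> tame_generators vars"
  shows "\<exists>a. quotient_action g = shear (specialize a) \<or>
    quotient_action g = transpose (shear (specialize a))"
proof -
  have idx: "i = 1 \<or> i = 2 \<or> i = 3" if "i \<in> {1..3::nat}" for i
    using that by auto
  note simps = quotient_action_def vec_eq_iff forall_2 shear_def transpose_def tame_T_def
    tame_S_def single_entry_def mat_def
  from assms consider (T) i j k :: nat and a where "{i, j, k} \<subseteq> {1..3}" "i \<noteq> j" "i \<noteq> k" "j < k"
      "g = tame_T vars (of_nat i) (of_nat j) (of_nat k) a"
    | (S) i j :: nat and a where "{i, j} \<subseteq> {1..3}" "i < j"
      "g = tame_S vars (of_nat i) (of_nat j) a"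
    unfolding tame_generators_def by blast
  then show ?thesis
  proof cases
    case T
    then consider "i = 1" "j = 2" "k = 3" | "i = 2" "j = 1" "k = 3" | "i = 3" "j = 1" "k = 2"
      using idx[of i] idx[of j] idx[of k] by auto
    then show ?thesis
    proof cases
      case 1
      then have "quotient_action g = shear (specialize a)"
        by (simp add: T(5) simps)
      then show ?thesis by blast
    next
      case 2
      then have "quotient_action g = transpose (shear (specialize a))"
        by (simp add: T(5) simps)
      then show ?thesis by blast
    next
      case 3
      then have "quotient_action g = shear (specialize (a * var1\<^sup>2))"
        by (simp add: T(5) simps power2_eq_square algebra_simps)
      then show ?thesis by blast
    qed
  next
    case S
    then consider "i = 1" "j = 2" | "i = 1" "j = 3" | "i = 2" "j = 3"
      using idx[of i] idx[of j] by auto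
    then show ?thesis
    proof cases
      case 1
      then have "quotient_action g = shear (specialize (- (a * var1\<^sup>2)))"
        by (simp add: S(3) simps power2_eq_square algebra_simps)
      then show ?thesis by blast
    next
      case 2
      then have "quotient_action g = shear (specialize 0)"
        by (simp add: S(3) simps power2_eq_square algebra_simps)
      then show ?thesis by blast
    next
      case 3
      then have "quotient_action g = shear (specialize (- (a * var1)))"
        by (simp add: S(3) simps power2_eq_square algebra_simps)
      then show ?thesis by blast
    qed
  qed
qed

lemma inv_tame_generator:
  assumes "g \<in> tame_generators c"
  shows "inv\<^bsub>stabilizer c\<^esub> g \<in> tame_generators c"
proof -
  interpret group "stabilizer c" by (rule group_stabilizer)
  have inv: "inv\<^bsub>stabilizer c\<^esub> g = h" if "h ** g = mat 1" "h \<in> tame_generators c" for h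
    using that assms tame_generators_subset[of c]
    by (intro inv_equality) (auto simp: stabilizer_def GL3_def)
  from assms consider (T) i j k :: nat and a where "{i, j, k} \<subseteq> {1..3}" "i \<noteq> j" "i \<noteq> k" "j < k"
      "g = tame_T c (of_nat i) (of_nat j) (of_nat k) a"
    | (S) i j :: nat and a where "{i, j} \<subseteq> {1..3}" "i < j"
      "g = tame_S c (of_nat i) (of_nat j) a"
    unfolding tame_generators_def by blast
  then show ?thesis
  proof cases
    case T
    define h where "h = tame_T c (of_nat i) (of_nat j) (of_nat k) (- a)"
    have h: "h \<in> tame_generators c"
      unfolding tame_generators_def h_def using T(1-4) by blast
    have "h ** g = mat 1"
      unfolding h_def T(5) using T(1-3) by (subst tame_T_mult) (auto simp: of_nat_index_3 tame_T_0)
    then show ?thesis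
      using inv[OF _ h] h by simp
  next
    case S
    define h where "h = tame_S c (of_nat i) (of_nat j) (- a)"
    have h: "h \<in> tame_generators c"
      unfolding tame_generators_def h_def using S(1,2) by blast
    have "h ** g = mat 1"
      unfolding h_def S(3) using S(1,2) by (subst tame_S_mult) (auto simp: of_nat_index_3 tame_S_0)
    then show ?thesis
      using inv[OF _ h] h by simp
  qed
qed

text \<open>
  The map \<open>v \<mapsto> v + a det(v, m, c) m\<close>; the vector in the definition is the cross product of \<open>m\<close> and \<open>c\<close>.
  It fixes \<open>c\<close>, and it also fixes \<open>m\<close>, so that replacing \<open>a\<close> by \<open>- a\<close> gives the inverse.
\<close>

definition transvection :: "'a::comm_ring_1 ^ 3 \<Rightarrow> 'a ^ 3 \<Rightarrow> 'a \<Rightarrow> 'a ^ 3 ^ 3" where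
  "transvection c m a = mat 1 + (\<chi> i j. a * m $ i *
     vector [m $ 2 * c $ 3 - m $ 3 * c $ 2, m $ 3 * c $ 1 - m $ 1 * c $ 3,
             m $ 1 * c $ 2 - m $ 2 * c $ 1] $ j)"

lemma transvection_in_stabilizer: "transvection c m a \<in> carrier (stabilizer c)"
proof (rule in_stabilizerI)
  have add: "transvection c m a ** transvection c m b = transvection c m (a + b)" for a b
    by (simp add: transvection_def vec_eq_iff forall_3 matrix_matrix_mult_def sum_3 mat_def
        algebra_simps)
  have zero: "transvection c m 0 = mat 1"
    by (simp add: transvection_def vec_eq_iff)
  show "transvection c m a ** transvection c m (- a) = mat 1"
    and "transvection c m (- a) ** transvection c m a = mat 1"
    by (simp_all add: add zero)
  show "transvection c m a *v c = c"
    by (simp add: transvection_def vec_eq_iff forall_3 matrix_vector_mult_def sum_3 mat_def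
        algebra_simps)
qed

text \<open>
  The vector \<open>m = (a\<^sub>1, p, 0)\<close> becomes \<open>(t, p)\<close> in the quotient. If \<open>p\<close> were invertible, then
  elementary operations would carry \<open>(t, p)\<close> to \<open>(0, p)\<close>, and the transvection would be a product of
  shears and constant matrices. That is why the prime has to be adapted to the finite set.
\<close>

lemma quotient_action_transvection:
  "quotient_action (transvection vars (vector [var1, of_int p, 0]) 1) *v vector [1, 0] =
    vector [[:1, of_int p:], [:(of_int p)\<^sup>2:]]"
  by (simp add: quotient_action_def transvection_def vec_eq_iff forall_2 matrix_vector_mult_def
      sum_2 mat_def power2_eq_square) (simp add: one_pCons)

section \<open>Infinite generation over the tame stabilizer\<close>

text \<open>
  Preservation is demanded of the inverse too, as mapping a set into itself is not inherited by
  inverses.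
\<close>

lemma subgroup_preserving_orbit:
  assumes "field_subring S"
  defines "W \<equiv> field_subring.orbit S"
  shows "subgroup {g \<in> carrier (stabilizer vars). (\<forall>w\<in>W. quotient_action g *v w \<in> W) \<and>
      (\<forall>w\<in>W. quotient_action (inv\<^bsub>stabilizer vars\<^esub> g) *v w \<in> W)} (stabilizer vars)"
    (is "subgroup ?H _")
proof -
  interpret group "stabilizer vars" by (rule group_stabilizer)
  have act: "quotient_action (g \<otimes>\<^bsub>stabilizer vars\<^esub> h) *v w =
      quotient_action g *v (quotient_action h *v w)"
    if "g \<in> carrier (stabilizer vars)" for g h w
  proof -
    have "g *v vars = vars"
      using that by (simp add: stabilizer_def)
    moreover have "g \<otimes>\<^bsub>stabilizer vars\<^esub> h = g ** h"
      by (simp add: stabilizer_def GL3_def)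
    ultimately show ?thesis
      by (simp add: quotient_action_mult matrix_vector_mul_assoc)
  qed
  have one: "\<one>\<^bsub>stabilizer vars\<^esub> = mat 1"
    by (simp add: stabilizer_def GL3_def)
  show ?thesis
  proof (rule subgroupI)
    have "\<one>\<^bsub>stabilizer vars\<^esub> \<in> ?H"
      using one_closed by (simp add: inv_one) (simp add: one quotient_action_one)
    then show "?H \<noteq> {}"
      by blast
  qed (auto simp: act inv_mult_group)
qed

theorem theorem7:
  fixes c :: "int_poly3 ^ 3"
    and L :: "(int_poly3 ^ 3 ^ 3) set"
  assumes "c = vector [var1, var2, var3]"
    and "finite L"
    and "L \<subseteq> carrier (stabilizer c)"
  shows "generate (stabilizer c) (L \<union> tame_stabilizer c) \<noteq> carrier (stabilizer c)"
proof
  assume gen: "generate (stabilizer c) (L \<union> tame_stabilizer c) = carrier (stabilizer c)"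
  interpret group "stabilizer vars" by (rule group_stabilizer)
  define L' where "L' = L \<union> (\<lambda>g. inv\<^bsub>stabilizer vars\<^esub> g) ` L"
  have "L' \<subseteq> carrier (stabilizer vars)"
    using assms by (auto simp: L'_def)
  then have "\<forall>g\<in>L'. \<exists>F. finite F \<and> (\<forall>S. field_subring S \<longrightarrow> F \<subseteq> S \<longrightarrow>
    (\<forall>w\<in>field_subring.orbit S. quotient_action g *v w \<in> field_subring.orbit S))"
    by (blast intro: invertible_preserves_orbit det_quotient_action)
  then obtain F where F: "\<And>g. g \<in> L' \<Longrightarrow> finite (F g)"
    "\<And>g S w. \<lbrakk>g \<in> L'; field_subring S; F g \<subseteq> S; w \<in> field_subring.orbit S\<rbrakk>
      \<Longrightarrow> quotient_action g *v w \<in> field_subring.orbit S"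
    by metis
  have "finite (\<Union>(F ` L'))"
    using F(1) assms(2) by (auto simp: L'_def)
  then obtain p where p: "prime p" and sub: "\<Union>(F ` L') \<subseteq> localization p"
    using finite_subset_localization by blast
  interpret S: field_subring "localization p"
    by (rule field_subring_localization[OF p])
  define H where "H = {g \<in> carrier (stabilizer vars).
      (\<forall>w\<in>S.orbit. quotient_action g *v w \<in> S.orbit) \<and>
      (\<forall>w\<in>S.orbit. quotient_action (inv\<^bsub>stabilizer vars\<^esub> g) *v w \<in> S.orbit)}"
  have subgroup_H: "subgroup H (stabilizer vars)"
    unfolding H_def by (rule subgroup_preserving_orbit[OF S.field_subring_axioms])
  have "L \<subseteq> H"
  proof
    fix g assume "g \<in> L"
    then have "g \<in> L'" "inv\<^bsub>stabilizer vars\<^esub> g \<in> L'"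
      by (auto simp: L'_def)
    then show "g \<in> H"
      using F(2)[OF _ S.field_subring_axioms] sub \<open>g \<in> L\<close> assms(1,3) by (auto simp: H_def)
  qed
  have tame: "quotient_action g *v w \<in> S.orbit" if "g \<in> tame_generators vars" "w \<in> S.orbit" for g w
  proof -
    have "specialize a \<in> S.polys" for a
      using of_int_in_localization[OF p] coeff_specialize[of a]
      by (auto simp: S.polys_def elim!: Ints_cases) (metis Ints_cases)
    then show ?thesis
      using quotient_action_tame[OF that(1)] S.orbit_shear S.orbit_shear_transpose that(2) by metis
  qed
  have "tame_generators vars \<subseteq> H"
    using tame inv_tame_generator tame_generators_subset[of vars] by (auto simp: H_def)
  then have "tame_stabilizer vars \<subseteq> H"
    unfolding tame_stabilizer_def by (rule generate_subgroup_incl[OF _ subgroup_H])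
  with \<open>L \<subseteq> H\<close> have "generate (stabilizer vars) (L \<union> tame_stabilizer vars) \<subseteq> H"
    by (intro generate_subgroup_incl[OF _ subgroup_H]) auto
  then have "transvection vars (vector [var1, of_int p, 0]) 1 \<in> H"
    using gen transvection_in_stabilizer unfolding assms(1) by blast
  moreover have "vector [1, 0] \<in> S.orbit"
    using S.reduced.start S.reduced_subset_orbit by blast
  ultimately have "vector [[:1, of_int p:], [:(of_int p)\<^sup>2:]] \<in> S.orbit"
    unfolding quotient_action_transvection[symmetric] by (simp add: H_def)
  moreover have "(of_int p :: rat) \<noteq> 0"
    using p by auto
  ultimately show False
    using S.Cohn_column_not_in_orbit inverse_prime_not_in_localization[OF p] by blast
qed

end
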